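(* For a given positive integer $n$, $$\lim_{k\to\infty} a_{n,k}=1,$$ where $a_{n,k}$ is the proportion of minimally overlapping patterns in $\mathcal{F}_{n,k}$.
   Context: For $n,k\ge 1$, $\mathcal{F}_{n,k}$ is the set of column-strict arrays with $n$ columns and $k$ rows: fillings of a rectangular array with $n$ columns and $k$ rows by the numbers $1,2,\ldots,kn$, each used exactly once, such that the entries increase from bottom to top in each column. Columns are labeled from left to right. (Reading the columns from left to right, each from bottom to top, identifies $\mathcal{F}_{n,k}$ with the set of permutations $\sigma$ of $\{1,\ldots,kn\}$ whose descent set is contained in $\{k,2k,\ldots,(n-1)k\}$.) If $F$ is a filling of a rectangle with $n$ columns and $k$ rows by distinct positive integers increasing from bottom to top in each column, then $\mathrm{red}(F)\in\mathcal{F}_{n,k}$ is obtained by replacing the $i$th smallest entry of $F$ by $i$, for all $i$. For $F\in\mathcal{F}_{n,k}$ and $1\le c_1<\cdots<c_j\le n$, $F[c_1,\ldots,c_j]$ is the filling with $j$ columns whose $a$th column is column $c_a$ of $F$. For $P\in\mathcal{F}_{j,k}$ and $F\in\mathcal{F}_{n,k}$ with $j\le n$, there is a $P$-match in $F$ starting at position $i$ if $\mathrm{red}(F[i,i+1,\ldots,i+j-1])=P$; $P\text{-mch}(F)$ is the number of $P$-matches in $F$. The pattern $P\in\mathcal{F}_{j,k}$ is minimally overlapping if the smallest $i$ for which there exists $F\in\mathcal{F}_{i,k}$ with $P\text{-mch}(F)=2$ is $i=2j-1$ (so two consecutive $P$-matches can overlap only in a single column, the last column of the first match and the first column of the second).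 $M_{n,k}$ is the number of minimally overlapping $P\in\mathcal{F}_{n,k}$, and $a_{n,k}=M_{n,k}/|\mathcal{F}_{n,k}|$.
   Formalization: The case n = 1 is excluded (n ≥ 2 is assumed): a one-column array has only one position for a match, so no pattern in F_{1,k} is minimally overlapping, a_{1,k} = 0 for all k, and the stated limit fails for n = 1. *)

theory Defs
  imports Complex_Main
begin

text \<open>
  An array is the list of its columns from left to right; a column is the list of its
  entries from bottom to top.
\<close>

definition column_strict_arrays :: "nat \<Rightarrow> nat \<Rightarrow> nat list list set" where
  "column_strict_arrays n k =
     {F. length F = n \<and> (\<forall>c\<in>set F. length c = k \<and> sorted_wrt (<) c) \<and>
         distinct (concat F) \<and> set (concat F) = {1..k * n}}"

definition red :: "nat list list \<Rightarrow> nat list list" where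
  "red F = map (map (\<lambda>x. card {y \<in> set (concat F). y \<le> x})) F"

text \<open>Column labels start at 1, as in the usual notation $F[c_1,\ldots,c_j]$.\<close>

definition select_columns :: "nat list list \<Rightarrow> nat list \<Rightarrow> nat list list" where
  "select_columns F cs = map (\<lambda>c. F ! (c - 1)) cs"

definition match_at :: "nat list list \<Rightarrow> nat list list \<Rightarrow> nat \<Rightarrow> bool" where
  "match_at P F i \<longleftrightarrow>
     1 \<le> i \<and> i + length P \<le> length F + 1 \<and> red (select_columns F [i..<i + length P]) = P"

definition mch :: "nat list list \<Rightarrow> nat list list \<Rightarrow> nat" where
  "mch P F = card {i. match_at P F i}"

definition minimally_overlapping :: "nat \<Rightarrow> nat \<Rightarrow> nat list list \<Rightarrow> bool" where
  "minimally_overlapping j k P \<longleftrightarrow>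
     P \<in> column_strict_arrays j k \<and>
     (\<exists>F\<in>column_strict_arrays (2 * j - 1) k. mch P F = 2) \<and>
     (\<forall>i<2 * j - 1. \<not> (\<exists>F\<in>column_strict_arrays i k. mch P F = 2))"

definition num_minimally_overlapping :: "nat \<Rightarrow> nat \<Rightarrow> nat" where
  "num_minimally_overlapping n k = card {P. minimally_overlapping n k P}"

definition minimally_overlapping_ratio :: "nat \<Rightarrow> nat \<Rightarrow> real" where
  "minimally_overlapping_ratio n k =
     real (num_minimally_overlapping n k) / real (card (column_strict_arrays n k))"

text \<open>
  A single column is degenerate: an array with \<open>2 * 1 - 1 = 1\<close> column has only one
  position where a match can start, so no one-column pattern is minimally overlapping, and
  the ratio is constantly 0. Asymptotic statements about it therefore need \<open>n \<ge> 2\<close>.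
\<close>

lemma minimally_overlapping_ratio_one_column: "minimally_overlapping_ratio 1 k = 0"
proof -
  have "\<not> minimally_overlapping 1 k P" for P
  proof
    assume *: "minimally_overlapping 1 k P"
    then have P: "length P = 1"
      by (simp add: minimally_overlapping_def column_strict_arrays_def)
    from * obtain F where F: "F \<in> column_strict_arrays 1 k" "mch P F = 2"
      by (auto simp: minimally_overlapping_def)
    then have "{i. match_at P F i} \<subseteq> {1}"
      using P by (auto simp: match_at_def column_strict_arrays_def)
    then have "mch P F \<le> card {1::nat}"
      unfolding mch_def by (intro card_mono) auto
    with F(2) show False by simp
  qed
  then show ?thesis
    by (simp add: minimally_overlapping_ratio_def num_minimally_overlapping_def)
qed

end

theory Submission
  imports Defs
begin

text \<open>
  If two matches of \<open>P\<close> overlap in at least two columns, with the second shifted by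
  \<open>1 \<le> s \<le> n - 2\<close>, then columns \<open>1, 2\<close> of \<open>P\<close> are order isomorphic to columns
  \<open>s + 1, s + 2\<close>. For \<open>s \<ge> 2\<close> the latter two columns can then be reconstructed from the
  other columns, so the proportion of such \<open>P\<close> is at most \<open>1 / (2 * k choose k)\<close>.
  For \<open>s = 1\<close> the relative order of the first three columns is determined by that of the
  pairs \<open>1, 2\<close> and \<open>1, 3\<close>, which leaves \<open>(2 * k choose k)\<^sup>2\<close> possibilities out of
  \<open>(3 * k choose k) * (2 * k choose k)\<close>, a proportion of at most \<open>(2 / 3) ^ k\<close>.
\<close>

subsection \<open>Ranks and reduction\<close>

definition rank :: "nat set \<Rightarrow> nat \<Rightarrow> nat" where
  "rank S x = card {y \<in> S. y \<le> x}"

text \<open>On \<open>{1..card S}\<close> this is the order isomorphism onto a finite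
  \<open>S\<close>; elsewhere its value is arbitrary.\<close>

definition unrank :: "nat set \<Rightarrow> nat \<Rightarrow> nat" where
  "unrank S = inv_into S (rank S)"

definition entries :: "nat list list \<Rightarrow> nat set" where
  "entries F = set (concat F)"

text \<open>Which numbers occur is left open, so that the notion passes to blocks of columns and to
  arrays before reduction.\<close>

definition column_strict :: "nat \<Rightarrow> nat list list \<Rightarrow> bool" where
  "column_strict k F \<longleftrightarrow> (\<forall>c\<in>set F. length c = k \<and> sorted_wrt (<) c) \<and> distinct (concat F)"

lemma entries_simps [simp]:
  "entries [] = {}" "entries (c # F) = set c \<union> entries F"
  "entries (F @ G) = entries F \<union> entries G" "entries (map (map f) F) = f ` entries F"
  by (auto simp: entries_def)

lemma finite_entries [simp]: "finite (entries F)"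
  by (simp add: entries_def)

lemma column_strict_Cons:
  "column_strict k (c # F) \<longleftrightarrow>
     length c = k \<and> sorted_wrt (<) c \<and> column_strict k F \<and> set c \<inter> entries F = {}"
  by (auto simp: column_strict_def entries_def strict_sorted_iff)

lemma column_strict_Nil [simp]: "column_strict k []"
  by (simp add: column_strict_def)

lemma column_strict_append:
  "column_strict k (F @ G) \<longleftrightarrow>
     column_strict k F \<and> column_strict k G \<and> entries F \<inter> entries G = {}"
  by (auto simp: column_strict_def entries_def)

lemma mem_column_strict_arrays:
  "F \<in> column_strict_arrays n k \<longleftrightarrow> length F = n \<and> column_strict k F \<and> entries F = {1..k * n}"
  by (auto simp: column_strict_arrays_def column_strict_def entries_def)

lemma card_entries: "column_strict k F \<Longrightarrow> card (entries F) = k * length F"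
  by (induction F)
     (auto simp: column_strict_Cons card_Un_disjoint strict_sorted_iff distinct_card)

lemma column_strict_map:
  assumes "column_strict k F" "strict_mono_on (entries F) f"
  shows "column_strict k (map (map f) F)"
  using assms
proof (induction F)
  case (Cons c F)
  have mono: "strict_mono_on (entries F) f" "strict_mono_on (set c) f"
    using Cons.prems(2) by (auto simp: strict_mono_on_def)
  have "inj_on f (entries (c # F))"
    using Cons.prems(2) by (rule strict_mono_on_imp_inj_on)
  then have "f ` set c \<inter> f ` entries F = {}"
    using Cons.prems(1) by (auto simp: column_strict_Cons inj_on_def)
  moreover have "sorted_wrt (<) (map f c)"
    using Cons.prems(1) mono(2)
    by (auto simp: column_strict_Cons sorted_wrt_map strict_mono_on_def
             intro: sorted_wrt_mono_rel[of _ "(<)"])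
  ultimately show ?case
    using Cons mono by (auto simp: column_strict_Cons)
qed simp

lemma finite_column_strict_arrays [simp]: "finite (column_strict_arrays n k)"
proof (rule finite_subset)
  show "column_strict_arrays n k \<subseteq>
    {F. set F \<subseteq> {c. set c \<subseteq> {1..k * n} \<and> length c = k} \<and> length F = n}"
    by (auto simp: column_strict_arrays_def)
  show "finite \<dots>"
    by (intro finite_lists_length_eq) simp
qed

section \<open>Ranks in a finite set as an order isomorphism\<close>

lemma rank_strict_mono: "finite S \<Longrightarrow> strict_mono_on S (rank S)"
  unfolding strict_mono_on_def rank_def
  by (intro allI impI psubset_card_mono) (force simp: psubset_eq)+

lemma rank_bij:
  assumes "finite S" shows "bij_betw (rank S) S {1..card S}"
proof -
  have inj: "inj_on (rank S) S"
    using rank_strict_mono[OF assms] by (rule strict_mono_on_imp_inj_on)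
  have "rank S ` S \<subseteq> {1..card S}"
  proof
    fix r assume "r \<in> rank S ` S"
    then obtain x where x: "x \<in> S" "r = rank S x" by auto
    have "{y \<in> S. y \<le> x} \<noteq> {}" using x by auto
    then show "r \<in> {1..card S}"
      using assms x by (auto simp: rank_def Suc_le_eq card_gt_0_iff intro: card_mono)
  qed
  moreover have "card (rank S ` S) = card {1..card S}"
    using inj by (simp add: card_image)
  ultimately have "rank S ` S = {1..card S}"
    by (intro card_subset_eq) auto
  with inj show ?thesis by (simp add: bij_betw_def)
qed

lemma unrank_rank: "finite S \<Longrightarrow> x \<in> S \<Longrightarrow> unrank S (rank S x) = x"
  using rank_bij[of S] by (simp add: unrank_def bij_betw_def)

lemma rank_unrank: "finite S \<Longrightarrow> i \<in> {1..card S} \<Longrightarrow> rank S (unrank S i) = i"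
  using rank_bij[of S] by (auto simp: unrank_def bij_betw_def intro: f_inv_into_f)

lemma unrank_bij: "finite S \<Longrightarrow> bij_betw (unrank S) {1..card S} S"
  unfolding unrank_def by (intro bij_betw_inv_into rank_bij)

lemma unrank_strict_mono:
  assumes "finite S" shows "strict_mono_on {1..card S} (unrank S)"
proof (rule strict_mono_onI)
  fix i j assume ij: "i \<in> {1..card S}" "j \<in> {1..card S}" "i < j"
  have mem: "unrank S i \<in> S" "unrank S j \<in> S"
    using unrank_bij[OF assms] ij by (auto simp: bij_betw_def)
  show "unrank S i < unrank S j"
  proof (rule ccontr)
    assume "\<not> ?thesis"
    then have "rank S (unrank S j) \<le> rank S (unrank S i)"
      using assms by (auto simp: rank_def intro!: card_mono)
    then show False using ij assms by (simp add: rank_unrank)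
  qed
qed

lemma rank_nth:
  assumes "sorted_wrt (<) c" "i < length c"
  shows "rank (set c) (c ! i) = Suc i"
proof -
  have "{y \<in> set c. y \<le> c ! i} = (!) c ` {..i}"
  proof (intro equalityI subsetI)
    fix y assume "y \<in> {y \<in> set c. y \<le> c ! i}"
    then obtain j where "j < length c" "y = c ! j" "c ! j \<le> c ! i"
      by (auto simp: in_set_conv_nth)
    with assms show "y \<in> (!) c ` {..i}"
      by (metis atMost_iff imageI leD not_le_imp_less sorted_wrt_nth_less)
  qed (use assms in \<open>auto simp: strict_sorted_iff intro: sorted_nth_mono\<close>)
  moreover have "inj_on ((!) c) {..i}"
    using assms by (auto simp: strict_sorted_iff intro!: inj_on_nth)
  ultimately show ?thesis by (simp add: rank_def card_image)
qed

lemma rank_image: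
  assumes "strict_mono_on S f" "x \<in> S"
  shows "rank (f ` S) (f x) = rank S x"
proof -
  have "{y \<in> f ` S. y \<le> f x} = f ` {y \<in> S. y \<le> x}"
    using assms by (auto simp: strict_mono_on_less_eq)
  moreover have "inj_on f {y \<in> S. y \<le> x}"
    using strict_mono_on_imp_inj_on[OF assms(1)] by (rule inj_on_subset) auto
  ultimately show ?thesis by (simp add: rank_def card_image)
qed

lemma rank_Un:
  "finite S \<Longrightarrow> finite T \<Longrightarrow> S \<inter> T = {} \<Longrightarrow> rank (S \<union> T) x = rank S x + rank T x"
  unfolding rank_def by (subst card_Un_disjoint[symmetric]) (auto intro!: arg_cong[of _ _ card])

section \<open>Reduction and order-preserving relabelling\<close>

lemma red_eq: "red F = map (map (rank (entries F))) F"
  by (simp add: red_def rank_def entries_def)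

lemma length_red [simp]: "length (red F) = length F"
  by (simp add: red_eq)

lemma map_map_cong:
  "(\<And>x. x \<in> entries F \<Longrightarrow> f x = g x) \<Longrightarrow> map (map f) F = map (map g) F"
  by (auto simp: entries_def)

lemma red_map:
  assumes "strict_mono_on (entries F) f"
  shows "red (map (map f) F) = red F"
proof -
  have "map (map (rank (f ` entries F) \<circ> f)) F = map (map (rank (entries F))) F"
    using rank_image[OF assms] by (intro map_map_cong) auto
  then show ?thesis by (simp add: red_eq)
qed

lemma red_array: "P \<in> column_strict_arrays n k \<Longrightarrow> red P = P"
proof -
  assume P: "P \<in> column_strict_arrays n k"
  have "rank {1..N} x = x" if "x \<in> {1..N}" for x N
  proof -
    have "{y \<in> {1..N}. y \<le> x} = {1..x}" using that by auto
    then show ?thesis by (simp add: rank_def)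
  qed
  then have "map (map (rank (entries P))) P = map (map (\<lambda>x. x)) P"
    using P by (intro map_map_cong) (auto simp: mem_column_strict_arrays)
  then show ?thesis by (simp add: red_eq)
qed

lemma red_mem_arrays:
  assumes "column_strict k F" shows "red F \<in> column_strict_arrays (length F) k"
  using assms rank_bij[of "entries F"] column_strict_map[OF assms rank_strict_mono]
  by (simp add: mem_column_strict_arrays red_eq card_entries bij_betw_def)

lemma map_unrank_red: "map (map (unrank (entries F))) (red F) = F"
proof -
  have "map (map (unrank (entries F) \<circ> rank (entries F))) F = map (map (\<lambda>x. x)) F"
    by (intro map_map_cong) (simp add: unrank_rank)
  then show ?thesis by (simp add: red_eq)
qed

text \<open>Together with \<open>map_unrank_red\<close>: once the entry set \<open>S\<close> is
  fixed, an array carries exactly the information of its reduction. The recursion for the number of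
  arrays and the replacement of blocks both rest on this.\<close>

lemma map_unrank_array:
  assumes "Q \<in> column_strict_arrays m k" "finite S" "card S = k * m"
  shows "column_strict k (map (map (unrank S)) Q)"
    and "entries (map (map (unrank S)) Q) = S"
    and "red (map (map (unrank S)) Q) = Q"
proof -
  have mono: "strict_mono_on (entries Q) (unrank S)"
    using assms unrank_strict_mono[of S] by (simp add: mem_column_strict_arrays)
  show "column_strict k (map (map (unrank S)) Q)"
    using assms mono by (auto simp: mem_column_strict_arrays intro: column_strict_map)
  show "entries (map (map (unrank S)) Q) = S"
    using assms unrank_bij[of S] by (auto simp: mem_column_strict_arrays bij_betw_def)
  show "red (map (map (unrank S)) Q) = Q"
    using mono red_array[OF assms(1)] by (simp add: red_map)
qed

lemma nth_entries_subset: "i < length F \<Longrightarrow> set (F ! i) \<subseteq> entries F"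
  using nth_mem by (fastforce simp: entries_def)

text \<open>Reducing the whole array is an order-preserving relabelling of the two chosen columns,
  and a further reduction does not see it.\<close>

lemma red_red_columns:
  assumes "i < length F" "j < length F"
  shows "red [red F ! i, red F ! j] = red [F ! i, F ! j]"
proof -
  have "strict_mono_on (entries [F ! i, F ! j]) (rank (entries F))"
    using rank_strict_mono[of "entries F"] nth_entries_subset[of i F] nth_entries_subset[of j F] assms
    by (auto simp: strict_mono_on_def)
  from red_map[OF this] show ?thesis
    using assms by (simp add: red_eq[of F])
qed

subsection \<open>Overlapping matches\<close>

text \<open>Only the first two columns of an overlap are compared; this necessary condition is all
  that the counting uses. It is meaningful only for \<open>s + 1 < length P\<close>.\<close>

definition self_similar :: "nat \<Rightarrow> nat list list \<Rightarrow> bool" where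
  "self_similar s P \<longleftrightarrow> red [P ! 0, P ! 1] = red [P ! s, P ! (s + 1)]"

lemma match_at_iff:
  "match_at P F i \<longleftrightarrow>
     1 \<le> i \<and> i + length P \<le> length F + 1 \<and> red (take (length P) (drop (i - 1) F)) = P"
proof -
  have "select_columns F [i..<i + length P] = take (length P) (drop (i - 1) F)"
    if "1 \<le> i" "i + length P \<le> length F + 1"
    using that by (intro nth_equalityI) (auto simp: select_columns_def)
  then show ?thesis unfolding match_at_def by auto
qed

lemma match_at_columns:
  assumes "match_at P F i" "a < length P" "b < length P"
  shows "red [P ! a, P ! b] = red [F ! (i - 1 + a), F ! (i - 1 + b)]"
proof -
  define G where "G = take (length P) (drop (i - 1) F)"
  have G: "red G = P" "length G = length P"
    using assms(1) by (auto simp: G_def match_at_iff)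
  have "G ! a = F ! (i - 1 + a)" "G ! b = F ! (i - 1 + b)"
    using assms by (auto simp: G_def match_at_iff)
  with red_red_columns[of a G b] G assms show ?thesis by simp
qed

text \<open>Columns \<open>j\<close> and \<open>j + 1\<close> of \<open>F\<close> are read twice: as
  the first two columns of the second match, and as the columns of the first match with 0-based
  indices \<open>j - i\<close> and \<open>j - i + 1\<close>. The last hypothesis says that the
  overlap has at least two columns.\<close>

lemma overlapping_matches_self_similar:
  assumes "match_at P F i" "match_at P F j" "i < j" "j - i + 2 \<le> length P"
  shows "self_similar (j - i) P"
proof -
  have "1 \<le> i" using assms by (simp add: match_at_def)
  with assms(3) have "i - 1 + (j - i) = j - 1 + 0" "i - 1 + (j - i + 1) = j - 1 + 1" by auto
  moreover have "j - i < length P" "j - i + 1 < length P" "0 < length P" "1 < length P"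
    using assms(3,4) by linarith+
  ultimately show ?thesis
    unfolding self_similar_def
    by (metis assms(1,2) match_at_columns)
qed

text \<open>
  Entries outside \<open>S\<close> are placed strictly between the multiples of \<open>M\<close> assigned to \<open>S\<close>;
  different offsets \<open>d\<close> keep the entries of the two overlapping copies apart.
\<close>

definition spread :: "nat \<Rightarrow> nat \<Rightarrow> nat set \<Rightarrow> nat \<Rightarrow> nat" where
  "spread M d S x = M * rank S x + (if x \<in> S then 0 else d + x)"

text \<open>A higher rank adds at least \<open>M\<close>, which exceeds every offset
  \<open>d + x\<close>. Among numbers of equal rank only the smallest can lie in \<open>S\<close>,
  and it has offset 0; the other offsets increase with \<open>x\<close>.\<close>

lemma spread_strict_mono:
  assumes "finite S" "d + N < M"
  shows "strict_mono_on {1..N} (spread M d S)"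
proof (rule strict_mono_onI)
  fix x y assume xy: "x \<in> {1..N}" "y \<in> {1..N}" "x < y"
  have le: "rank S x \<le> rank S y"
    using assms xy by (auto simp: rank_def intro!: card_mono)
  show "spread M d S x < spread M d S y"
  proof (cases "rank S x = rank S y")
    case True
    have "y \<notin> S"
    proof
      assume "y \<in> S"
      then have "{z \<in> S. z \<le> x} \<subset> {z \<in> S. z \<le> y}" using xy by force
      then have "rank S x < rank S y"
        using assms by (auto simp: rank_def intro!: psubset_card_mono)
      with True show False by simp
    qed
    with True xy show ?thesis by (auto simp: spread_def)
  next
    case False
    have "spread M d S x < M * (rank S x + 1)"
      using xy assms by (auto simp: spread_def)
    also have "\<dots> \<le> M * rank S y"
      using le False by (intro mult_le_mono2) auto
    also have "\<dots> \<le> spread M d S y"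
      by (simp add: spread_def)
    finally show ?thesis .
  qed
qed

text \<open>Two relabelled copies of \<open>P\<close> are glued along one column: \<open>f\<close>
  and \<open>g\<close> send the last column \<open>a\<close> of the first copy and the first column
  \<open>b\<close> of the second to the same column. Reducing the result gives the array
  sought.\<close>

lemma exists_two_matches:
  assumes P: "P \<in> column_strict_arrays n k" and "n \<ge> 1"
  shows "\<exists>F\<in>column_strict_arrays (2 * n - 1) k. match_at P F 1 \<and> match_at P F n"
proof -
  have len: "length P = n" and cs: "column_strict k P" and ent: "entries P = {1..k * n}"
    using P by (auto simp: mem_column_strict_arrays)
  obtain b D where bD: "P = b # D"
    using len \<open>n \<ge> 1\<close> by (cases P) auto
  obtain T a where Ta: "P = T @ [a]"
    using len \<open>n \<ge> 1\<close> by (cases P rule: rev_cases) auto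
  define N M where "N = k * n" and "M = 2 * N + 1"
  \<comment> \<open>Modulo \<open>M\<close>, entries of the shared column get residue 0, the others
    residues in \<open>1..N\<close> under \<open>f\<close> and in \<open>N + 1..2 * N\<close> under
    \<open>g\<close>, so no unintended coincidence can occur.\<close>
  define f g where "f = spread M 0 (set a)" and "g = spread M N (set b)"
  have f: "strict_mono_on (entries P) f" and g: "strict_mono_on (entries P) g"
    unfolding f_def g_def ent N_def[symmetric]
    by (intro spread_strict_mono; simp add: M_def)+
  have a: "length a = k" "sorted_wrt (<) a"
    using cs Ta by (simp_all add: column_strict_append column_strict_Cons)
  have b: "length b = k" "sorted_wrt (<) b"
    using cs bD by (simp_all add: column_strict_append column_strict_Cons)
  \<comment> \<open>Both maps send the entry with 0-based row index \<open>i\<close> to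
    \<open>M * Suc i\<close>, since its rank in its own column depends on the row only.\<close>
  have fa: "map f a = map g b"
    using a b by (intro nth_equalityI) (auto simp: f_def g_def spread_def rank_nth)
  define G where "G = map (map f) P @ map (map g) D"
  have G_eq: "G = map (map f) T @ map (map g) P"
  proof -
    have "map (map f) P = map (map f) T @ [map f a]" by (simp add: Ta)
    moreover have "map (map g) P = map g b # map (map g) D" by (simp add: bD)
    ultimately show ?thesis by (simp add: G_def fa)
  qed
  have lenG: "length G = 2 * n - 1"
    using len bD by (simp add: G_def)
  have "f x \<noteq> g y" if "x \<in> entries P" "y \<in> entries D" for x y
  proof
    assume eq: "f x = g y"
    have "y \<notin> set b" "y \<in> {1..N}" "x \<in> {1..N}"
      using that cs ent bD by (auto simp: column_strict_Cons N_def)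
    then have "N + y < M" "x < M" by (auto simp: M_def)
    with \<open>y \<notin> set b\<close> have "g y mod M = N + y" "f x mod M = (if x \<in> set a then 0 else x)"
      by (auto simp: f_def g_def spread_def)
    with eq \<open>y \<in> {1..N}\<close> \<open>x \<in> {1..N}\<close> show False by (auto split: if_splits)
  qed
  moreover have "column_strict k (map (map f) P)" "column_strict k (map (map g) P)"
    using cs f g by (auto intro: column_strict_map)
  ultimately have csG: "column_strict k G"
    by (auto simp: G_def column_strict_append) (auto simp: bD column_strict_Cons)
  have fst_match: "red (take n G) = P"
    using len red_map[OF f] red_array[OF P] by (simp add: G_def)
  have snd_match: "red (drop (n - 1) G) = P"
    using len Ta red_map[OF g] red_array[OF P] by (simp add: G_eq)
  \<comment> \<open>The entries of \<open>G\<close> are not an initial segment. Passing to ranks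
    repairs this, and being order-preserving it keeps both matches.\<close>
  define R where "R = rank (entries G)"
  have R: "strict_mono_on (entries H) R" if "entries H \<subseteq> entries G" for H
    using that rank_strict_mono[of "entries G"] by (auto simp: R_def strict_mono_on_def)
  have F: "red G = map (map R) G" by (simp add: red_eq R_def)
  have "entries (take n G) \<subseteq> entries G" "entries (drop (n - 1) G) \<subseteq> entries G"
    by (auto simp: entries_def dest: in_set_takeD in_set_dropD)
  from this[THEN R, THEN red_map]
  have "red (take n (red G)) = P" "red (drop (n - 1) (red G)) = P"
    using fst_match snd_match by (simp_all add: F take_map drop_map)
  moreover have "red G \<in> column_strict_arrays (2 * n - 1) k"
    using red_mem_arrays[OF csG] lenG by simp
  ultimately show ?thesis
    using len lenG \<open>n \<ge> 1\<close> by (intro bexI[of _ "red G"]) (auto simp: match_at_iff)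
qed

text \<open>Without self-similarity two matches start at least \<open>n - 1\<close> apart. Hence two
  matches need \<open>2 * n - 1\<close> columns, and the glued array with that many columns has no
  room for a third.\<close>

lemma minimally_overlappingI:
  assumes P: "P \<in> column_strict_arrays n k" and "n \<ge> 2"
    and not_sim: "\<And>s. 1 \<le> s \<Longrightarrow> s + 2 \<le> n \<Longrightarrow> \<not> self_similar s P"
  shows "minimally_overlapping n k P"
  unfolding minimally_overlapping_def
proof (intro conjI allI impI notI)
  have len: "length P = n" using P by (simp add: mem_column_strict_arrays)
  have far: "n \<le> j - i + 1" if "match_at P F i" "match_at P F j" "i < j" for F i j
    using overlapping_matches_self_similar[OF that] not_sim[of "j - i"] that(3) len by force
  show "P \<in> column_strict_arrays n k" by fact
  from exists_two_matches[OF P] \<open>n \<ge> 2\<close> obtain F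
    where F: "F \<in> column_strict_arrays (2 * n - 1) k" "match_at P F 1" "match_at P F n"
    by auto
  have "{i. match_at P F i} = {1, n}"
  proof (intro equalityI subsetI)
    fix i assume "i \<in> {i. match_at P F i}"
    then have i: "match_at P F i" "1 \<le> i" "i \<le> n"
      using F(1) len \<open>n \<ge> 2\<close> by (auto simp: match_at_iff mem_column_strict_arrays)
    with far[OF F(2) i(1)] show "i \<in> {1, n}" by force
  qed (use F in auto)
  with F \<open>n \<ge> 2\<close> show "\<exists>F\<in>column_strict_arrays (2 * n - 1) k. mch P F = 2"
    by (intro bexI[of _ F]) (auto simp: mch_def)
  fix m assume "m < 2 * n - 1" "\<exists>F\<in>column_strict_arrays m k. mch P F = 2"
  then obtain F where F: "F \<in> column_strict_arrays m k" "mch P F = 2" by auto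
  then obtain i j where "{i. match_at P F i} = {i, j}" "i \<noteq> j"
    by (auto simp: mch_def card_2_iff)
  then obtain i j where "match_at P F i" "match_at P F j" "i < j"
    by (metis (mono_tags, lifting) insertCI linorder_neqE_nat mem_Collect_eq)
  moreover from this have "1 \<le> i" "j + n \<le> m + 1"
    using F(1) len by (auto simp: match_at_iff mem_column_strict_arrays)
  ultimately show False
    using far[of F i j] \<open>m < 2 * n - 1\<close> by linarith
qed

subsection \<open>Counting\<close>

lemma card_column_strict_arrays_0: "card (column_strict_arrays 0 k) = 1"
proof -
  have "column_strict_arrays 0 k = {[]}" by (auto simp: mem_column_strict_arrays)
  then show ?thesis by simp
qed

lemma card_column_strict_arrays_Suc:
  "card (column_strict_arrays (Suc n) k) =
     (k * Suc n choose k) * card (column_strict_arrays n k)"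
proof -
  define V where "V = {1..k * Suc n}"
  define A where "A = {S. S \<subseteq> V \<and> card S = k}"
  have "bij_betw (\<lambda>P. (set (hd P), red (tl P))) (column_strict_arrays (Suc n) k)
          (A \<times> column_strict_arrays n k)"
  proof (rule bij_betw_byWitness[where
        f' = "\<lambda>(S, Q). sorted_list_of_set S # map (map (unrank (V - S))) Q"])
    have split: "length c = k" "sorted_wrt (<) c" "column_strict k F" "length F = n"
        "entries F = V - set c" "set c \<in> A"
      if "c # F \<in> column_strict_arrays (Suc n) k" for c F
      using that by (auto simp: mem_column_strict_arrays column_strict_Cons A_def V_def
          strict_sorted_iff distinct_card)
    show "\<forall>P\<in>column_strict_arrays (Suc n) k.
      (case (set (hd P), red (tl P)) of (S, Q) \<Rightarrow>
         sorted_list_of_set S # map (map (unrank (V - S))) Q) = P"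
    proof
      fix P assume P: "P \<in> column_strict_arrays (Suc n) k"
      then obtain c F where cF: "P = c # F"
        by (cases P) (auto simp: mem_column_strict_arrays)
      note s = split[of c F, folded cF, OF P]
      have "map (map (unrank (V - set c))) (red F) = F"
        using map_unrank_red[of F] s by simp
      moreover have "sorted_list_of_set (set c) = c"
        using s by (simp add: strict_sorted_iff sorted_list_of_set.idem_if_sorted_distinct)
      ultimately show "(case (set (hd P), red (tl P)) of (S, Q) \<Rightarrow>
         sorted_list_of_set S # map (map (unrank (V - S))) Q) = P"
        by (simp add: cF)
    qed
    have join: "finite S" "finite (V - S)" "card (V - S) = k * n" if "S \<in> A" for S
    proof -
      have "S \<subseteq> V" "card S = k" using that by (auto simp: A_def)
      moreover from this show "finite S" by (auto simp: V_def intro: finite_subset)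
      ultimately show "finite (V - S)" "card (V - S) = k * n"
        by (auto simp: V_def card_Diff_subset)
    qed
    show "\<forall>SQ\<in>A \<times> column_strict_arrays n k.
      (\<lambda>P. (set (hd P), red (tl P)))
        (case SQ of (S, Q) \<Rightarrow> sorted_list_of_set S # map (map (unrank (V - S))) Q) = SQ"
    proof
      fix SQ assume "SQ \<in> A \<times> column_strict_arrays n k"
      then obtain S Q where SQ: "SQ = (S, Q)" "S \<in> A" "Q \<in> column_strict_arrays n k" by auto
      then show "(\<lambda>P. (set (hd P), red (tl P)))
        (case SQ of (S, Q) \<Rightarrow> sorted_list_of_set S # map (map (unrank (V - S))) Q) = SQ"
        using join[OF SQ(2)] map_unrank_array(3)[OF SQ(3) join(2,3)[OF SQ(2)]] by simp
    qed
    show "(\<lambda>P. (set (hd P), red (tl P))) ` column_strict_arrays (Suc n) k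
      \<subseteq> A \<times> column_strict_arrays n k"
    proof (rule image_subsetI)
      fix P assume P: "P \<in> column_strict_arrays (Suc n) k"
      then obtain c F where cF: "P = c # F"
        by (cases P) (auto simp: mem_column_strict_arrays)
      note s = split[of c F, folded cF, OF P]
      then show "(set (hd P), red (tl P)) \<in> A \<times> column_strict_arrays n k"
        using red_mem_arrays[of k F] by (simp add: cF)
    qed
    show "(\<lambda>(S, Q). sorted_list_of_set S # map (map (unrank (V - S))) Q) `
      (A \<times> column_strict_arrays n k) \<subseteq> column_strict_arrays (Suc n) k"
    proof (rule image_subsetI)
      fix SQ assume "SQ \<in> A \<times> column_strict_arrays n k"
      then obtain S Q where SQ: "SQ = (S, Q)" "S \<in> A" "Q \<in> column_strict_arrays n k" by auto
      have "S \<subseteq> V" "card S = k" using SQ by (auto simp: A_def)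
      then show "(\<lambda>(S, Q). sorted_list_of_set S # map (map (unrank (V - S))) Q) SQ
        \<in> column_strict_arrays (Suc n) k"
        using join[OF SQ(2)] map_unrank_array[OF SQ(3) join(2,3)[OF SQ(2)]] SQ(3)
        by (auto simp: SQ(1) mem_column_strict_arrays column_strict_Cons V_def)
    qed
  qed
  then have "card (column_strict_arrays (Suc n) k) = card (A \<times> column_strict_arrays n k)"
    by (rule bij_betw_same_card)
  also have "card A = (k * Suc n choose k)"
    unfolding A_def V_def by (subst n_subsets) auto
  then have "card (A \<times> column_strict_arrays n k) =
      (k * Suc n choose k) * card (column_strict_arrays n k)"
    by (simp only: card_cartesian_product)
  finally show ?thesis .
qed

lemma card_column_strict_arrays_2: "card (column_strict_arrays 2 k) = (2 * k choose k)"
  using card_column_strict_arrays_Suc[of 1 k] card_column_strict_arrays_Suc[of 0 k]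
  by (simp add: card_column_strict_arrays_0 numeral_2_eq_2)

lemma card_column_strict_arrays_3:
  "card (column_strict_arrays 3 k) = (3 * k choose k) * (2 * k choose k)"
  using card_column_strict_arrays_Suc[of 2 k]
  by (simp add: card_column_strict_arrays_2 numeral_3_eq_3 mult.commute del: mult_Suc mult_Suc_right)

lemma card_column_strict_arrays_pos: "card (column_strict_arrays n k) > 0"
  by (induction n) (simp_all add: card_column_strict_arrays_0 card_column_strict_arrays_Suc
      zero_less_binomial_iff del: mult_Suc_right)

section \<open>Counting by replacing a block of columns\<close>

definition replace_block :: "nat \<Rightarrow> nat list list \<Rightarrow> nat list list \<Rightarrow> nat list list" where
  "replace_block s P Q =
     take s P @ map (map (unrank (entries (take (length Q) (drop s P))))) Q @ drop (s + length Q) P"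

text \<open>The block keeps its entry set, so the new array uses the same numbers. Putting back the
  former pattern undoes the replacement, hence \<open>P\<close> is determined by the new array and
  the erased pattern.\<close>

lemma replace_block:
  assumes P: "P \<in> column_strict_arrays n k" and Q: "Q \<in> column_strict_arrays m k"
    and "s + m \<le> n"
  shows "replace_block s P Q \<in> column_strict_arrays n k"
    and "red (take m (drop s (replace_block s P Q))) = Q"
    and "replace_block s (replace_block s P Q) (red (take m (drop s P))) = P"
    and "i < s \<Longrightarrow> replace_block s P Q ! i = P ! i"
proof -
  define T B D where "T = take s P" and "B = take m (drop s P)" and "D = drop (s + m) P"
  have len: "length P = n" "length Q = m"
    using P Q by (auto simp: mem_column_strict_arrays)
  have P_eq: "P = T @ B @ D"
    by (simp add: T_def B_def D_def) (metis add.commute append_take_drop_id drop_drop)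
  have lens: "length T = s" "length B = m" "length D = n - (s + m)"
    using len assms(3) by (auto simp: T_def B_def D_def)
  have cs: "column_strict k T" "column_strict k B" "column_strict k D"
    using P by (auto simp: mem_column_strict_arrays P_eq column_strict_append)
  define B' where "B' = map (map (unrank (entries B))) Q"
  have B': "column_strict k B'" "entries B' = entries B" "red B' = Q" "length B' = m"
    using map_unrank_array[OF Q finite_entries, of B] cs(2) lens len
    by (simp_all add: B'_def card_entries)
  have rep: "replace_block s P Q = T @ B' @ D"
    by (simp add: replace_block_def T_def B'_def D_def B_def len)
  show "replace_block s P Q \<in> column_strict_arrays n k"
    unfolding rep using P B' lens len P_eq
    by (simp add: mem_column_strict_arrays column_strict_append)
  show "red (take m (drop s (replace_block s P Q))) = Q"
    unfolding rep using lens B' by simp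
  show "replace_block s (replace_block s P Q) (red (take m (drop s P))) = P"
    unfolding rep unfolding replace_block_def B_def[symmetric]
    using lens B' map_unrank_red[of B] by (simp add: P_eq[symmetric])
  show "replace_block s P Q ! i = P ! i" if "i < s"
    unfolding rep using that lens by (simp add: nth_append) (simp add: T_def)
qed

text \<open>
  \<open>h\<close> is the extra information needed to recover the pattern of the block from the
  array with the block replaced.
\<close>

lemma card_block_bound:
  assumes "s + m \<le> n" and X: "X \<subseteq> column_strict_arrays n k"
    and "finite H" "h ` X \<subseteq> H"
    and recover: "\<And>P P'. P \<in> X \<Longrightarrow> P' \<in> X \<Longrightarrow> h P = h P' \<Longrightarrow>
       (\<And>i. i < s \<Longrightarrow> P ! i = P' ! i) \<Longrightarrow>
       red (take m (drop s P)) = red (take m (drop s P'))"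
  shows "card X * card (column_strict_arrays m k) \<le> card (column_strict_arrays n k) * card H"
proof -
  \<comment> \<open>Injectivity of this map gives the bound: the new array shows \<open>Q\<close>
    and the columns left of the block, these columns and \<open>h P\<close> yield the erased pattern
    by \<open>recover\<close>, and the erased pattern restores \<open>P\<close>.\<close>
  define \<Phi> where "\<Phi> = (\<lambda>(P, Q). (replace_block s P Q, h P))"
  have "inj_on \<Phi> (X \<times> column_strict_arrays m k)"
  proof (rule inj_onI, clarify)
    fix P Q P' Q'
    assume PQ: "P \<in> X" "Q \<in> column_strict_arrays m k" "P' \<in> X" "Q' \<in> column_strict_arrays m k"
      and "\<Phi> (P, Q) = \<Phi> (P', Q')"
    then have eq: "replace_block s P Q = replace_block s P' Q'" "h P = h P'"
      by (auto simp: \<Phi>_def)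
    \<comment> \<open>\<open>r(1)\<close> to \<open>r(4)\<close> are the four conclusions for
      \<open>P\<close> and \<open>Q\<close>, and \<open>r(5)\<close> to \<open>r(8)\<close> the same
      for \<open>P'\<close> and \<open>Q'\<close>.\<close>
    note r = replace_block[OF _ PQ(2) assms(1), of P] replace_block[OF _ PQ(4) assms(1), of P']
    have "Q = Q'" using r(2,6) eq PQ X by auto
    moreover have "red (take m (drop s P)) = red (take m (drop s P'))"
      using r(4,8) eq PQ X by (intro recover) (auto, metis subsetD)
    then have "P = P'" using r(3,7) eq PQ X by (metis subsetD)
    ultimately show "P = P' \<and> Q = Q'" by simp
  qed
  moreover have "\<Phi> ` (X \<times> column_strict_arrays m k) \<subseteq> column_strict_arrays n k \<times> H"
    using replace_block(1)[OF _ _ assms(1)] X assms(4) by (auto simp: \<Phi>_def)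
  ultimately have "card (X \<times> column_strict_arrays m k) \<le> card (column_strict_arrays n k \<times> H)"
    using \<open>finite H\<close> by (intro card_inj_on_le[of \<Phi>]) auto
  then show ?thesis by (simp add: card_cartesian_product)
qed

lemma take2_drop: "s + 1 < length P \<Longrightarrow> take 2 (drop s P) = [P ! s, P ! (s + 1)]"
  by (simp add: numeral_2_eq_2 Cons_nth_drop_Suc[symmetric])

text \<open>For \<open>2 \<le> s\<close> the first two columns lie left of the block and survive its
  replacement. They show the erased pattern, so a one-element \<open>H\<close> suffices.\<close>

lemma card_self_similar_disjoint:
  assumes "2 \<le> s" "s + 2 \<le> n"
  shows "card {P \<in> column_strict_arrays n k. self_similar s P} * (2 * k choose k)
    \<le> card (column_strict_arrays n k)"
proof -
  define X where "X = {P \<in> column_strict_arrays n k. self_similar s P}"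
  have block: "red (take 2 (drop s P)) = red [P ! 0, P ! 1]" if "P \<in> X" for P
    using that assms by (simp add: X_def take2_drop self_similar_def mem_column_strict_arrays)
  have "card X * card (column_strict_arrays 2 k) \<le> card (column_strict_arrays n k) * card {()}"
    using assms by (intro card_block_bound[where s = s and h = "\<lambda>_. ()"]) (auto simp: X_def block)
  then show ?thesis by (simp add: card_column_strict_arrays_2 X_def)
qed

text \<open>
  The rank of an entry among three columns is obtained from its ranks among the pairs of
  columns by inclusion--exclusion, its rank in its own column being its row.
\<close>

lemma red_three_columns:
  assumes X: "column_strict k [x, y, z]" and X': "column_strict k [x', y', z']"
    and xy: "red [x, y] = red [x', y']" and xz: "red [x, z] = red [x', z']"
    and yz: "red [y, z] = red [y', z']"
  shows "red [x, y, z] = red [x', y', z']"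
proof -
  have len: "length x = k" "length y = k" "length z = k"
      "length x' = k" "length y' = k" "length z' = k"
    and sorted: "sorted_wrt (<) x" "sorted_wrt (<) y" "sorted_wrt (<) z"
      "sorted_wrt (<) x'" "sorted_wrt (<) y'" "sorted_wrt (<) z'"
    and disj: "set x \<inter> set y = {}" "set x \<inter> set z = {}" "set y \<inter> set z = {}"
      "set x' \<inter> set y' = {}" "set x' \<inter> set z' = {}" "set y' \<inter> set z' = {}"
    using X X' by (auto simp: column_strict_Cons)
  have disj3: "set x \<inter> (set y \<union> set z) = {}" "set x' \<inter> (set y' \<union> set z') = {}"
    using disj by auto
  \<comment> \<open>Ranks in the union of two columns agree by hypothesis and split into sums
    because the columns are disjoint.\<close>
  have pairs:
    "rank (set u) (u ! i) + rank (set v) (u ! i) = rank (set u') (u' ! i) + rank (set v') (u' ! i)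
     \<and> rank (set u) (v ! i) + rank (set v) (v ! i) = rank (set u') (v' ! i) + rank (set v') (v' ! i)"
    if "red [u, v] = red [u', v']" "set u \<inter> set v = {}" "set u' \<inter> set v' = {}"
      "length u = k" "length v = k" "length u' = k" "length v' = k" "i < k" for u v u' v' i
  proof -
    have "map (rank (set u \<union> set v)) u ! i = map (rank (set u' \<union> set v')) u' ! i"
         "map (rank (set u \<union> set v)) v ! i = map (rank (set u' \<union> set v')) v' ! i"
      using that(1) by (simp_all add: red_eq)
    then show ?thesis using that by (simp add: rank_Un)
  qed
  have "rank (set x \<union> (set y \<union> set z)) (x ! i) = rank (set x' \<union> (set y' \<union> set z')) (x' ! i)
    \<and> rank (set x \<union> (set y \<union> set z)) (y ! i) = rank (set x' \<union> (set y' \<union> set z')) (y' ! i)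
    \<and> rank (set x \<union> (set y \<union> set z)) (z ! i) = rank (set x' \<union> (set y' \<union> set z')) (z' ! i)"
    if "i < k" for i
    using pairs[OF xy disj(1,4) len(1,2,4,5) that] pairs[OF xz disj(2,5) len(1,3,4,6) that]
      pairs[OF yz disj(3,6) len(2,3,5,6) that] that
    by (simp add: rank_Un disj disj3 rank_nth sorted len)
  then show ?thesis
    by (simp add: red_eq) (auto intro!: nth_equalityI simp: len)
qed

text \<open>The block starts at the first column, so nothing to its left helps and \<open>h\<close>
  must supply the patterns of columns 1, 2 and 1, 3; self-similarity adds that of columns 2, 3. One
  factor \<open>2 * k choose k\<close> cancels at the end.\<close>

lemma card_self_similar_1:
  assumes "3 \<le> n"
  shows "card {P \<in> column_strict_arrays n k. self_similar 1 P} * (3 * k choose k)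
    \<le> card (column_strict_arrays n k) * (2 * k choose k)"
proof -
  define X where "X = {P \<in> column_strict_arrays n k. self_similar 1 P}"
  define H where "H = column_strict_arrays 2 k \<times> column_strict_arrays 2 k"
  define h where "h P = (red [P ! 0, P ! 1], red [P ! 0, P ! 2])" for P
  have cols: "take 3 P = [P ! 0, P ! 1, P ! 2] \<and> column_strict k [P ! 0, P ! 1, P ! 2]
      \<and> red [P ! 0, P ! 1] = red [P ! 1, P ! 2]" if "P \<in> X" for P
  proof -
    have len: "length P = n" and cs: "column_strict k P"
      using that by (auto simp: X_def mem_column_strict_arrays)
    have eq: "take 3 P = [P ! 0, P ! 1, P ! 2]"
      using len assms by (intro nth_equalityI) (auto simp: numeral_3_eq_3 less_Suc_eq numeral_2_eq_2)
    have "column_strict k (take 3 P)"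
      using cs append_take_drop_id[of 3 P] column_strict_append by metis
    then show ?thesis
      using eq that by (simp add: X_def self_similar_def numeral_2_eq_2)
  qed
  have "card X * card (column_strict_arrays 3 k) \<le> card (column_strict_arrays n k) * card H"
  proof (rule card_block_bound[where s = 0 and h = h])
    show "h ` X \<subseteq> H"
    proof (rule image_subsetI)
      fix P assume "P \<in> X"
      with cols have "column_strict k [P ! 0, P ! 1]" "column_strict k [P ! 0, P ! 2]"
        by (auto simp: column_strict_Cons)
      from this[THEN red_mem_arrays] show "h P \<in> H"
        by (simp add: h_def H_def numeral_2_eq_2)
    qed
    show "red (take 3 (drop 0 P)) = red (take 3 (drop 0 P'))"
      if "P \<in> X" "P' \<in> X" "h P = h P'" for P P'
      using that cols[of P] cols[of P'] red_three_columns[of k "P ! 0" "P ! 1" "P ! 2"]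
      by (simp add: h_def)
  qed (use assms in \<open>auto simp: X_def H_def\<close>)
  then have "(card X * (3 * k choose k)) * (2 * k choose k)
      \<le> (card (column_strict_arrays n k) * (2 * k choose k)) * (2 * k choose k)"
    by (simp add: card_column_strict_arrays_3 card_column_strict_arrays_2 H_def
        card_cartesian_product mult_ac)
  then show ?thesis
    by (simp add: X_def zero_less_binomial_iff)
qed

section \<open>Estimates and the limit\<close>

lemma binomial_ratio_bound: "(3 / 2) ^ k * real (2 * k choose k) \<le> real (3 * k choose k)"
proof -
  \<comment> \<open>The upper index rises from \<open>2 * k\<close> to \<open>3 * k\<close> in
    single steps. Each step from \<open>m\<close> multiplies the binomial coefficient by
    \<open>(m + 1) / (m + 1 - k)\<close>, which is at least 3/2 because
    \<open>m + 1 \<le> 3 * k\<close>.\<close>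
  have "(3 / 2) ^ j * real (2 * k choose k) \<le> real (2 * k + j choose k)" if "j \<le> k" for j
    using that
  proof (induction j)
    case (Suc j)
    define m where "m = 2 * k + j"
    have "real (Suc m - k) * real (Suc m choose k) = real (Suc m) * real (m choose k)"
      using binomial_absorb_comp[of "Suc m" k] by (metis diff_Suc_1 of_nat_mult)
    moreover have "real (Suc m) \<ge> 3 / 2 * real (Suc m - k)" "real (Suc m - k) > 0"
      using Suc.prems by (auto simp: m_def)
    ultimately have "real (Suc m - k) * real (Suc m choose k)
        \<ge> real (Suc m - k) * (3 / 2 * real (m choose k))"
      using mult_right_mono[of "3 / 2 * real (Suc m - k)" "real (Suc m)" "real (m choose k)"]
      by (simp add: mult_ac)
    then have "3 / 2 * real (m choose k) \<le> real (Suc m choose k)"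
      using \<open>real (Suc m - k) > 0\<close> mult_le_cancel_left_pos by blast
    with Suc show ?case by (simp add: m_def)
  qed simp
  from this[of k] show ?thesis by simp
qed

lemma minimally_overlapping_ratio_le_1: "minimally_overlapping_ratio n k \<le> 1"
proof -
  have "num_minimally_overlapping n k \<le> card (column_strict_arrays n k)"
    unfolding num_minimally_overlapping_def
    by (intro card_mono) (auto simp: minimally_overlapping_def)
  then show ?thesis
    by (simp add: minimally_overlapping_ratio_def divide_le_eq_1 card_column_strict_arrays_pos)
qed

text \<open>A union bound over the shifts \<open>1..n - 2\<close>: the number of shifts does not
  depend on \<open>k\<close>, so crude bounds for each shift suffice.\<close>

lemma minimally_overlapping_ratio_ge:
  assumes "n \<ge> 2" "k \<ge> 1"
  shows "minimally_overlapping_ratio n k \<ge> 1 - real n * ((2 / 3) ^ k + 1 / real k)"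
proof -
  define C where "C = column_strict_arrays n k"
  define B where "B s = {P \<in> C. self_similar s P}" for s
  \<comment> \<open>The first summand serves the shift 1 and the second all larger shifts; their sum
    is one bound for every shift.\<close>
  define \<epsilon> where "\<epsilon> = (2 / 3) ^ k + 1 / real k"
  have C: "card C > 0" "finite C" by (auto simp: C_def card_column_strict_arrays_pos)
  have B: "real (card (B s)) \<le> \<epsilon> * real (card C)" if s: "s \<in> {1..n - 2}" for s
  proof (cases "s = 1")
    case True
    have pos: "real (2 * k choose k) > 0" by (simp add: zero_less_binomial_iff)
    have "real (card (B s)) * ((3 / 2) ^ k * real (2 * k choose k))
        \<le> real (card (B s)) * real (3 * k choose k)"
      using binomial_ratio_bound by (intro mult_left_mono) auto
    also have "\<dots> \<le> real (card C) * real (2 * k choose k)"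
      using card_self_similar_1[of n k] s True unfolding B_def C_def
      by (simp only: of_nat_mult[symmetric] of_nat_le_iff) simp
    finally have "real (card (B s)) * (3 / 2) ^ k \<le> real (card C)"
      using pos by (simp add: mult.assoc[symmetric])
    then have "real (card (B s)) \<le> (2 / 3) ^ k * real (card C)"
      by (simp add: field_simps)
    also have "\<dots> \<le> \<epsilon> * real (card C)"
      by (intro mult_right_mono) (auto simp: \<epsilon>_def)
    finally show ?thesis .
  next
    case False
    have "2 * k choose 1 \<le> 2 * k choose k"
      using binomial_maximum[of "2 * k" 1] by simp
    then have "k \<le> 2 * k choose k" by simp
    then have "card (B s) * k \<le> card (B s) * (2 * k choose k)" by simp
    also have "\<dots> \<le> card C"
      using card_self_similar_disjoint[of s n k] s False by (auto simp: B_def C_def)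
    finally have "real (card (B s)) * real k \<le> real (card C)"
      by (metis of_nat_le_iff of_nat_mult)
    then have "real (card (B s)) \<le> 1 / real k * real (card C)"
      using \<open>k \<ge> 1\<close> by (simp add: field_simps)
    also have "\<dots> \<le> \<epsilon> * real (card C)"
      by (intro mult_right_mono) (auto simp: \<epsilon>_def)
    finally show ?thesis .
  qed
  have sub: "{P. minimally_overlapping n k P} \<subseteq> C"
    by (auto simp: minimally_overlapping_def C_def)
  \<comment> \<open>For \<open>n = 2\<close> the index set is empty, and every pattern is minimally
    overlapping.\<close>
  have "C \<subseteq> {P. minimally_overlapping n k P} \<union> (\<Union>s\<in>{1..n - 2}. B s)"
    using minimally_overlappingI[of _ n k] assms by (fastforce simp: C_def B_def)
  then have "card C \<le> card ({P. minimally_overlapping n k P} \<union> (\<Union>s\<in>{1..n - 2}. B s))"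
    using C sub by (intro card_mono) (auto simp: B_def intro: finite_subset)
  also have "\<dots> \<le> num_minimally_overlapping n k + (\<Sum>s\<in>{1..n - 2}. card (B s))"
    unfolding num_minimally_overlapping_def
    by (rule order.trans[OF card_Un_le add_left_mono[OF card_UN_le]]) simp
  finally have "real (card C) \<le>
      real (num_minimally_overlapping n k) + (\<Sum>s\<in>{1..n - 2}. real (card (B s)))"
    by (metis of_nat_add of_nat_le_iff of_nat_sum)
  also have "(\<Sum>s\<in>{1..n - 2}. real (card (B s))) \<le> (\<Sum>s\<in>{1..n - 2}. \<epsilon> * real (card C))"
    by (intro sum_mono B)
  also have "\<dots> = real (n - 2) * (\<epsilon> * real (card C))" by simp
  also have "\<dots> \<le> real n * (\<epsilon> * real (card C))"
    by (intro mult_right_mono) (auto simp: \<epsilon>_def)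
  finally have "(1 - real n * \<epsilon>) * real (card C) \<le> real (num_minimally_overlapping n k)"
    by (simp add: algebra_simps)
  then show ?thesis
    using C by (simp add: minimally_overlapping_ratio_def C_def[symmetric] \<epsilon>_def pos_le_divide_eq)
qed

theorem corollary7:
  fixes n :: nat
  assumes "n \<ge> 2"
  shows "(\<lambda>k. minimally_overlapping_ratio n k) \<longlonglongrightarrow> 1"
proof (rule tendsto_sandwich)
  have "(\<lambda>k. 1 - real n * ((2 / 3) ^ k + 1 / real k)) \<longlonglongrightarrow> 1 - real n * (0 + 0)"
    by (intro tendsto_intros LIMSEQ_power_zero lim_1_over_n) simp
  then show "(\<lambda>k. 1 - real n * ((2 / 3) ^ k + 1 / real k)) \<longlonglongrightarrow> 1" by simp
  show "\<forall>\<^sub>F k in sequentially.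
      1 - real n * ((2 / 3) ^ k + 1 / real k) \<le> minimally_overlapping_ratio n k"
    using eventually_ge_at_top[of "1 :: nat"]
    by eventually_elim (rule minimally_overlapping_ratio_ge[OF assms])
  show "\<forall>\<^sub>F k in sequentially. minimally_overlapping_ratio n k \<le> 1"
    by (simp add: minimally_overlapping_ratio_le_1)
qed simp

end
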